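(* Let $k\geq 2$ be an integer. Let $G$ be a connected graph of order $n$, and suppose that $\delta(G)\geq \sqrt{k(k-1)(k+2\sqrt{2k}+2)\,n}$. Then $G$ has a $[2,k]$-ST.
   Context: All graphs are finite and simple. $\delta(G)$ denotes the minimum degree of $G$. For a tree $T$ and an integer $i\geq 0$, $V_i(T)$ is the set of vertices of degree exactly $i$ in $T$. A spanning tree $T$ of $G$ is called a $[2,k]$-ST of $G$ if $\bigcup_{2\leq i\leq k}V_i(T)=\emptyset$, i.e., $T$ has no vertex whose degree lies in $\{2,3,\ldots,k\}$. *)

theory Defs
  imports Complex_Main "Graph_Theory.Graph_Theory"
begin

text \<open>
  A finite simple graph is a \<^locale>\<open>pair_graph\<close>: a finite vertex set with a symmetric,
  irreflexive set of ordered pairs. Since every undirected edge is represented by both of its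
  orientations, the degree of a vertex is its \<^const>\<open>out_degree\<close>.
\<close>

definition min_degree :: "'a pair_pre_digraph \<Rightarrow> nat" where
  "min_degree G = Min (out_degree G ` verts G)"

text \<open>
  The library constants \<^const>\<open>tree\<close> and \<^const>\<open>spanning_tree\<close> cannot be used here: they
  exclude directed cycles, so in a symmetric digraph any edge, traversed back and forth, would
  count as a cycle. The directed cycles with at least three arcs of a symmetric digraph are
  exactly the cycles of the undirected graph.
\<close>

definition undirected_tree :: "'a pair_pre_digraph \<Rightarrow> bool" where
  "undirected_tree T \<longleftrightarrow> pair_graph T \<and> Digraph_Component.connected T \<and>
     \<not> (\<exists>p. pre_digraph.cycle T p \<and> 3 \<le> length p)"

definition undirected_spanning_tree :: "'a pair_pre_digraph \<Rightarrow> 'a pair_pre_digraph \<Rightarrow> bool" where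
  "undirected_spanning_tree T G \<longleftrightarrow> undirected_tree T \<and> spanning T G"

definition verts_of_degree :: "nat \<Rightarrow> 'a pair_pre_digraph \<Rightarrow> 'a set" where
  "verts_of_degree i T = {v \<in> verts T. out_degree T v = i}"

definition is_2_k_ST :: "nat \<Rightarrow> 'a pair_pre_digraph \<Rightarrow> 'a pair_pre_digraph \<Rightarrow> bool" where
  "is_2_k_ST k T G \<longleftrightarrow> undirected_spanning_tree T G \<and> (\<Union>i\<in>{2..k}. verts_of_degree i T) = {}"

end

theory Submission
  imports Defs
begin

text \<open>
  Put \<open>d = \<delta>(G)\<close> and \<open>t = \<lceil>2d/5\<rceil>\<close>. Grow a rooted tree by repeatedly adding large stars, that is,
  centres with at least \<open>t\<close> children each, joined to the tree directly or through one or two further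
  vertices. There are \<open>O(n/t)\<close> centres, and when the process stops every vertex has fewer than \<open>t\<close>
  neighbours outside the tree. Then let any vertex with at least \<open>k\<close> neighbours outside the tree absorb
  all of them. When this stops, double counting the edges between the tree and the \<open>m\<close> remaining
  vertices gives \<open>m (d - t + 1) \<le> (k - 1) n\<close>; hang these vertices arbitrarily as leaves.

  The number of bad vertices, those with \<open>1, \<dots>, k - 1\<close> children, is now \<open>O(n/t + m)\<close>. A bad vertex \<open>u\<close>
  has about \<open>d - t\<close> neighbours that are children of star centres, and it can adopt any of them that is
  not one of its ancestors. The degree condition ensures that there are enough such neighbours and
  that no centre is ever exhausted.
\<close>

section \<open>Rooted trees as parent functions\<close>

definition children :: "'a set \<Rightarrow> 'a \<Rightarrow> ('a \<Rightarrow> 'a) \<Rightarrow> 'a \<Rightarrow> 'a set" where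
  "children C r par p = {v \<in> C - {r}. par v = p}"

definition par_rel :: "'a set \<Rightarrow> 'a \<Rightarrow> ('a \<Rightarrow> 'a) \<Rightarrow> 'a rel" where
  "par_rel C r par = {(par v, v) | v. v \<in> C - {r}}"

text \<open>No arc leaves the head of a new arc, so a path that uses one ends there. A closed path
  starts at a vertex with an outgoing arc and therefore stays within \<open>R\<close>.\<close>

lemma acyclic_Un_fresh_range:
  assumes "acyclic R" and fresh: "Range X \<inter> (Domain R \<union> Domain X) = {}"
  shows "acyclic (R \<union> X)"
proof (rule acyclicI, intro allI notI)
  fix x assume xx: "(x, x) \<in> (R \<union> X)\<^sup>+"
  have reach: "(x, y) \<in> R\<^sup>+ \<or> y \<in> Range X" if "(x, y) \<in> (R \<union> X)\<^sup>+" for y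
    using that
  proof (induction rule: trancl_induct)
    case (base y)
    then show ?case by auto
  next
    case (step y z)
    then show ?case using fresh by (auto intro: trancl_into_trancl)
  qed
  have "x \<in> Domain (R \<union> X)"
    using xx by (metis Domain.DomainI trancl_domain)
  then show False
    using reach[OF xx] assms by (auto simp: acyclic_def)
qed

locale fin_graph =
  fixes V :: "'a set" and E :: "'a \<Rightarrow> 'a \<Rightarrow> bool"
  assumes finV: "finite V"
    and E_V: "E x y \<Longrightarrow> x \<in> V \<and> y \<in> V"
    and E_sym: "E x y \<Longrightarrow> E y x"
    and E_irrefl: "\<not> E x x"
begin

lemma finite_nb [simp]: "finite {w. E v w}"
  using E_V by (auto intro: finite_subset[OF _ finV])

text \<open>Every vertex except \<open>r\<close> has its parent in the finite set \<open>C\<close>,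
  so acyclicity forces each chain of parents to end at \<open>r\<close>: this is a subtree of the
  graph with vertex set \<open>C\<close>. The value \<open>par r\<close> is arbitrary.\<close>

definition rtree :: "'a set \<Rightarrow> 'a \<Rightarrow> ('a \<Rightarrow> 'a) \<Rightarrow> bool" where
  "rtree C r par \<longleftrightarrow> r \<in> C \<and> C \<subseteq> V \<and> (\<forall>v\<in>C - {r}. par v \<in> C \<and> E v (par v)) \<and>
     acyclic (par_rel C r par)"

lemma rtree_finite: "rtree C r par \<Longrightarrow> finite C"
  unfolding rtree_def using finV finite_subset by blast

lemma finite_children: "rtree C r par \<Longrightarrow> finite (children C r par p)"
  using rtree_finite by (auto simp: children_def)

lemma rtree_attach:
  assumes T: "rtree C r par" and Q: "Q \<subseteq> V - C" and f: "\<And>q. q \<in> Q \<Longrightarrow> f q \<in> C \<and> E q (f q)"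
  shows "rtree (C \<union> Q) r (override_on par f Q)"
proof -
  let ?X = "{(f q, q) | q. q \<in> Q}"
  have eq: "par_rel (C \<union> Q) r (override_on par f Q) = par_rel C r par \<union> ?X"
    using T Q by (auto simp: par_rel_def rtree_def override_on_def)
  have "acyclic (par_rel C r par \<union> ?X)"
  proof (rule acyclic_Un_fresh_range)
    show "acyclic (par_rel C r par)" using T by (simp add: rtree_def)
    have "Domain (par_rel C r par) \<subseteq> C" using T by (auto simp: par_rel_def rtree_def)
    moreover have "Domain ?X \<subseteq> C" "Range ?X \<subseteq> Q" using f by auto
    ultimately show "Range ?X \<inter> (Domain (par_rel C r par) \<union> Domain ?X) = {}"
      using Q by blast
  qed
  then show ?thesis
    using T Q f unfolding rtree_def eq by (auto simp: override_on_def)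
qed

lemma children_attach:
  assumes "rtree C r par" "Q \<subseteq> V - C"
  shows "children (C \<union> Q) r (override_on par f Q) p = children C r par p \<union> {q \<in> Q. f q = p}"
  using assms by (auto simp: children_def rtree_def override_on_def)

text \<open>The subtree below \<open>q\<close> moves along with it; a cycle could arise only if
  \<open>u\<close> lay in that subtree. Acyclicity is shown with the old arc into \<open>q\<close>
  still present, which is stronger.\<close>

lemma rtree_move:
  assumes T: "rtree C r par" and q: "q \<in> C - {r}" and u: "u \<in> C" "E q u"
    and anc: "(q, u) \<notin> (par_rel C r par)\<^sup>*"
  shows "rtree C r (par(q := u))"
proof -
  have "par_rel C r (par(q := u)) \<subseteq> insert (u, q) (par_rel C r par)"
    by (auto simp: par_rel_def)
  moreover have "acyclic (insert (u, q) (par_rel C r par))"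
    using T anc by (simp add: acyclic_insert rtree_def)
  ultimately show ?thesis
    using T u unfolding rtree_def by (auto intro: acyclic_subset)
qed

lemma children_move:
  assumes "q \<in> C - {r}" "par q \<noteq> u"
  shows "children C r (par(q := u)) v =
    (if v = u then insert q (children C r par u) else children C r par v - {q})"
  using assms by (auto simp: children_def)

text \<open>The ancestors of \<open>u\<close> form a chain, so each vertex is the parent of at most one of them.\<close>

lemma card_ancestors_le:
  assumes T: "rtree C r par" and S: "finite S"
  shows "card {q \<in> C - {r}. (q, u) \<in> (par_rel C r par)\<^sup>* \<and> par q \<in> S} \<le> card S"
proof (rule card_inj_on_le[OF _ _ S])
  let ?R = "par_rel C r par"
  have sv: "single_valued (?R\<inverse>)"
    by (auto simp: single_valued_def par_rel_def)
  have acyc: "acyclic ?R" using T by (simp add: rtree_def)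
  \<comment> \<open>If \<open>q1\<close> were a proper ancestor of \<open>q2\<close>, the common
    parent would lie on the path from \<open>q1\<close> to \<open>q2\<close>, closing a cycle
    through \<open>q1\<close>.\<close>
  have eq: "q1 = q2" if q12: "(q1, q2) \<in> ?R\<^sup>*" "par q1 = par q2" "q1 \<in> C - {r}" for q1 q2
  proof (rule ccontr)
    assume "q1 \<noteq> q2"
    then obtain p where "(q1, p) \<in> ?R\<^sup>*" "(p, q2) \<in> ?R"
      using q12(1) by (meson rtranclE)
    moreover from this have "p = par q1" using q12 by (auto simp: par_rel_def)
    moreover have "(par q1, q1) \<in> ?R" using q12 by (auto simp: par_rel_def)
    ultimately have "(q1, q1) \<in> ?R\<^sup>+" by (meson rtrancl_into_trancl1)
    then show False using acyc by (auto simp: acyclic_def)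
  qed
  show "inj_on par {q \<in> C - {r}. (q, u) \<in> ?R\<^sup>* \<and> par q \<in> S}"
  proof (rule inj_onI)
    fix q1 q2
    assume q: "q1 \<in> {q \<in> C - {r}. (q, u) \<in> ?R\<^sup>* \<and> par q \<in> S}"
      "q2 \<in> {q \<in> C - {r}. (q, u) \<in> ?R\<^sup>* \<and> par q \<in> S}" and pq: "par q1 = par q2"
    then have "(u, q1) \<in> (?R\<inverse>)\<^sup>*" "(u, q2) \<in> (?R\<inverse>)\<^sup>*"
      by (auto simp: rtrancl_converse)
    from single_valued_confluent[OF sv this] have "(q2, q1) \<in> ?R\<^sup>* \<or> (q1, q2) \<in> ?R\<^sup>*"
      by (auto simp: rtrancl_converse)
    then show "q1 = q2" using eq q pq by (metis (lifting) mem_Collect_eq)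
  qed
qed auto

section \<open>Repairing bad vertices\<close>

text \<open>A non-root has degree one more than its number of children, so for \<open>r\<close> in
  \<open>S\<close> these are the vertices outside \<open>S\<close> with degree between 2 and
  \<open>k\<close>.\<close>

definition bad :: "nat \<Rightarrow> 'a \<Rightarrow> 'a set \<Rightarrow> ('a \<Rightarrow> 'a) \<Rightarrow> 'a set" where
  "bad k r S par = {v \<in> V - S. children V r par v \<noteq> {} \<and> card (children V r par v) < k}"

text \<open>A bad vertex \<open>u\<close> adopts neighbours (with their whole subtrees) from vertices of \<open>S\<close>,
  one at a time; \<open>M\<close> bounds the number of adoptions that are still needed.\<close>

lemma repair_bad:
  assumes "rtree V r par" "S \<subseteq> V" "r \<in> S"
    and "(\<Sum>u\<in>bad k r S par. k - card (children V r par u)) \<le> M"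
    and "\<And>p. p \<in> S \<Longrightarrow> k + 1 + M \<le> card (children V r par p)"
    and "\<And>u. u \<in> bad k r S par \<Longrightarrow> card S + M \<le> card {q. E u q \<and> q \<noteq> r \<and> par q \<in> S}"
  shows "\<exists>par. rtree V r par \<and> k + 1 \<le> card (children V r par r) \<and>
    (\<forall>v\<in>V. children V r par v = {} \<or> k \<le> card (children V r par v))"
  using assms
proof (induction M arbitrary: par)
  case 0
  have "finite (bad k r S par)" using finV by (auto simp: bad_def)
  then have "bad k r S par = {}"
    using "0.prems"(4) by (force simp: bad_def)
  then have "children V r par v = {} \<or> k \<le> card (children V r par v)" if "v \<in> V" for v
    using that "0.prems"(5)[of v] by (cases "v \<in> S") (auto simp: bad_def not_less)
  then show ?case using 0 by (metis add.right_neutral)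
next
  case (Suc M)
  show ?case
  proof (cases "bad k r S par = {}")
    case True
    then have "children V r par v = {} \<or> k \<le> card (children V r par v)" if "v \<in> V" for v
      using that Suc.prems(5)[of v] by (cases "v \<in> S") (auto simp: bad_def not_less)
    moreover have "k + 1 \<le> card (children V r par r)"
      using Suc.prems(5)[OF Suc.prems(3)] by simp
    ultimately show ?thesis using Suc.prems by blast
  next
    case False
    then obtain u where u: "u \<in> bad k r S par" by blast
    let ?A = "{q \<in> V - {r}. (q, u) \<in> (par_rel V r par)\<^sup>* \<and> par q \<in> S}"
    let ?B = "{q. E u q \<and> q \<noteq> r \<and> par q \<in> S}"
    have finS: "finite S" using Suc.prems(2) finV finite_subset by blast
    \<comment> \<open>At most \<open>card S\<close> ancestors have a parent in \<open>S\<close>, and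
      at least one adoption is outstanding, so some candidate in \<open>?B\<close> is not an
      ancestor of \<open>u\<close>.\<close>
    have "card ?A < card ?B"
      using card_ancestors_le[OF Suc.prems(1) finS, of u] Suc.prems(6)[OF u] by linarith
    then have "\<not> ?B \<subseteq> ?A"
      using card_mono[of ?A ?B] finV by auto
    then obtain q where q: "E u q" "q \<noteq> r" "par q \<in> S" "(q, u) \<notin> (par_rel V r par)\<^sup>*"
      using E_V by blast
    have qV: "q \<in> V - {r}" and uV: "u \<in> V" "u \<notin> S"
      using q E_V u by (auto simp: bad_def)
    define par' where "par' = par(q := u)"
    have T': "rtree V r par'"
      unfolding par'_def using rtree_move[OF Suc.prems(1) qV uV(1) E_sym[OF q(1)] q(4)] .
    have ch: "children V r par' v =
        (if v = u then insert q (children V r par u) else children V r par v - {q})" for v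
      unfolding par'_def using children_move[OF qV] q(3) uV(2) by metis
    have ch_other: "children V r par' v = children V r par v" if "v \<noteq> u" "v \<notin> S" for v
      using that q(3) ch by (auto simp: children_def)
    have q_notin: "q \<notin> children V r par u" using q(3) uV(2) by (auto simp: children_def)
    have card_u: "card (children V r par' u) = Suc (card (children V r par u))"
      using q_notin finite_children[OF Suc.prems(1)] by (simp add: ch)
    \<comment> \<open>The vertex \<open>q\<close> came from a member of \<open>S\<close>, so no
      vertex outside \<open>S\<close> loses a child and none becomes bad.\<close>
    have sub: "bad k r S par' \<subseteq> bad k r S par"
    proof
      fix v assume v: "v \<in> bad k r S par'"
      show "v \<in> bad k r S par"
      proof (cases "v = u")
        case False
        then show ?thesis using v ch_other[of v] by (auto simp: bad_def)
      qed (use u in simp)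
    qed
    have finb: "finite (bad k r S par)" using finV by (auto simp: bad_def)
    have "(\<Sum>v\<in>bad k r S par'. k - card (children V r par' v))
        \<le> (\<Sum>v\<in>bad k r S par. k - card (children V r par' v))"
      by (rule sum_mono2[OF finb sub]) simp
    also have "\<dots> < (\<Sum>v\<in>bad k r S par. k - card (children V r par v))"
    proof (rule sum_strict_mono_ex1[OF finb])
      show "\<forall>v\<in>bad k r S par. k - card (children V r par' v) \<le> k - card (children V r par v)"
      proof
        fix v assume "v \<in> bad k r S par"
        then have "v \<notin> S" by (simp add: bad_def)
        then show "k - card (children V r par' v) \<le> k - card (children V r par v)"
          using ch_other[of v] card_u by (cases "v = u") auto
      qed
      show "\<exists>v\<in>bad k r S par. k - card (children V r par' v) < k - card (children V r par v)"
        using u card_u by (intro bexI[of _ u]) (auto simp: bad_def)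
    qed
    finally have sum': "(\<Sum>v\<in>bad k r S par'. k - card (children V r par' v)) \<le> M"
      using Suc.prems(4) by linarith
    \<comment> \<open>One adoption costs a centre at most one child, and below costs a bad vertex at
      most the candidate \<open>q\<close>; the drop from \<open>Suc M\<close> to \<open>M\<close>
      pays for both.\<close>
    have S': "k + 1 + M \<le> card (children V r par' p)" if "p \<in> S" for p
    proof -
      have "p \<noteq> u" using that uV by blast
      then have "card (children V r par p) - 1 \<le> card (children V r par' p)"
        using ch[of p] diff_card_le_card_Diff[of "{q}" "children V r par p"] by simp
      then show ?thesis using Suc.prems(5)[OF that] by linarith
    qed
    have nb': "card S + M \<le> card {q. E v q \<and> q \<noteq> r \<and> par' q \<in> S}"
      if "v \<in> bad k r S par'" for v
    proof -
      have "{q. E v q \<and> q \<noteq> r \<and> par q \<in> S} - {q} \<subseteq> {q. E v q \<and> q \<noteq> r \<and> par' q \<in> S}"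
        by (auto simp: par'_def)
      then have "card ({q. E v q \<and> q \<noteq> r \<and> par q \<in> S} - {q})
          \<le> card {q. E v q \<and> q \<noteq> r \<and> par' q \<in> S}"
        by (intro card_mono) (auto intro: finite_subset[OF _ finite_nb[of v]])
      then have "card {q. E v q \<and> q \<noteq> r \<and> par q \<in> S} - 1
          \<le> card {q. E v q \<and> q \<noteq> r \<and> par' q \<in> S}"
        using diff_card_le_card_Diff[of "{q}" "{q. E v q \<and> q \<noteq> r \<and> par q \<in> S}"] by simp
      moreover have "v \<in> bad k r S par" using that sub by blast
      ultimately show ?thesis using Suc.prems(6)[of v] by linarith
    qed
    show ?thesis using Suc.IH[OF T' Suc.prems(2,3) sum' S' nb'] .
  qed
qed

section \<open>Trees of large stars\<close>

text \<open>\<open>S\<close> consists of star centres and \<open>D\<close> contains all other internal vertices. The counter \<open>e\<close> bounds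
  the number of vertices that are not children of a centre: nothing can be adopted from these.\<close>

definition star_tree ::
  "nat \<Rightarrow> 'a set \<Rightarrow> 'a \<Rightarrow> ('a \<Rightarrow> 'a) \<Rightarrow> 'a set \<Rightarrow> 'a set \<Rightarrow> nat \<Rightarrow> nat \<Rightarrow> nat \<Rightarrow> bool" where
  "star_tree t C r par S D s e b \<longleftrightarrow> rtree C r par \<and> S \<subseteq> C \<and> r \<in> S \<and> D \<subseteq> C \<and>
     (\<forall>v\<in>C - (S \<union> D). children C r par v = {}) \<and> (\<forall>p\<in>S. t \<le> card (children C r par p)) \<and>
     card S \<le> s \<and> card {v \<in> C. v = r \<or> par v \<notin> S} \<le> e \<and> card D \<le> b"

lemma star_tree_mono:
  "star_tree t C r par S D s e b \<Longrightarrow> s \<le> s' \<Longrightarrow> e \<le> e' \<Longrightarrow> b \<le> b' \<Longrightarrow>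
    star_tree t C r par S D s' e' b'"
  by (auto simp: star_tree_def)

text \<open>The parent \<open>y\<close> need not be a centre, so \<open>c\<close> is charged to
  \<open>e\<close>; \<open>y\<close> may receive its first child, so it is charged to
  \<open>D\<close>.\<close>

lemma star_tree_hang:
  assumes T: "star_tree t C r par S D s e b" and y: "y \<in> C" and c: "c \<in> V - C" "E c y"
  shows "star_tree t (insert c C) r (override_on par (\<lambda>_. y) {c}) S (insert y D)
    s (Suc e) (Suc b)"
proof -
  let ?par = "override_on par (\<lambda>_. y) {c}"
  have R: "rtree C r par" using T by (simp add: star_tree_def)
  have R': "rtree (insert c C) r ?par"
    using rtree_attach[OF R, of "{c}" "\<lambda>_. y"] y c by simp
  have ch: "children (insert c C) r ?par p = children C r par p \<union> {q \<in> {c}. y = p}" for p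
    using children_attach[OF R, of "{c}" "\<lambda>_. y"] c by simp
  have finC: "finite C" using rtree_finite[OF R] .
  have "{v \<in> insert c C. v = r \<or> ?par v \<notin> S} \<subseteq> insert c {v \<in> C. v = r \<or> par v \<notin> S}"
    by (auto simp: override_on_def)
  then have "card {v \<in> insert c C. v = r \<or> ?par v \<notin> S}
      \<le> card (insert c {v \<in> C. v = r \<or> par v \<notin> S})"
    using finC by (intro card_mono) auto
  also have "\<dots> \<le> Suc (card {v \<in> C. v = r \<or> par v \<notin> S})"
    by (rule card_insert_le_m1) auto
  finally have e: "card {v \<in> insert c C. v = r \<or> ?par v \<notin> S} \<le> Suc e"
    using T by (simp add: star_tree_def)
  have b: "card (insert y D) \<le> Suc b"
    using T card_insert_le_m1[of "Suc b" D y] by (simp add: star_tree_def)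
  have chS: "t \<le> card (children (insert c C) r ?par p)" if "p \<in> S" for p
  proof -
    have "card (children C r par p) \<le> card (children (insert c C) r ?par p)"
      using finite_children[OF R'] ch by (intro card_mono) auto
    then show ?thesis using T that by (fastforce simp: star_tree_def)
  qed
  have "children C r par c = {}"
    using R c by (auto simp: children_def rtree_def)
  then show ?thesis
    using T R' e b chS y c by (auto simp: star_tree_def ch)
qed

text \<open>All new vertices are children of a centre, so \<open>e\<close> does not grow; the only
  cost is \<open>c\<close> itself, if it was not yet a centre.\<close>

lemma star_tree_fan:
  assumes T: "star_tree t C r par S D s e b" and c: "c \<in> C"
    and Q: "Q \<subseteq> V - C" "\<And>q. q \<in> Q \<Longrightarrow> E c q" and big: "c \<in> S \<or> t \<le> card Q"
  shows "star_tree t (C \<union> Q) r (override_on par (\<lambda>_. c) Q) (insert c S) D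
    (if c \<in> S then s else Suc s) e b"
proof -
  let ?par = "override_on par (\<lambda>_. c) Q"
  have R: "rtree C r par" using T by (simp add: star_tree_def)
  have R': "rtree (C \<union> Q) r ?par"
    by (rule rtree_attach[OF R Q(1)]) (use c Q(2) E_sym in blast)
  have ch: "children (C \<union> Q) r ?par p = children C r par p \<union> {q \<in> Q. c = p}" for p
    using children_attach[OF R, of Q "\<lambda>_. c"] Q by simp
  have finC: "finite C" using rtree_finite[OF R] .
  have "{v \<in> C \<union> Q. v = r \<or> ?par v \<notin> insert c S} \<subseteq> {v \<in> C. v = r \<or> par v \<notin> S}"
    using R Q by (auto simp: override_on_def rtree_def)
  then have "card {v \<in> C \<union> Q. v = r \<or> ?par v \<notin> insert c S}
      \<le> card {v \<in> C. v = r \<or> par v \<notin> S}"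
    using finC by (intro card_mono) auto
  then have e: "card {v \<in> C \<union> Q. v = r \<or> ?par v \<notin> insert c S} \<le> e"
    using T by (simp add: star_tree_def)
  have chS: "t \<le> card (children (C \<union> Q) r ?par p)" if "p \<in> insert c S" for p
  proof (cases "p \<in> S")
    case True
    have "card (children C r par p) \<le> card (children (C \<union> Q) r ?par p)"
      using finite_children[OF R'] ch by (intro card_mono) auto
    then show ?thesis using T True by (fastforce simp: star_tree_def)
  next
    case False
    then have p: "p = c" "t \<le> card Q" using that big by auto
    have "card Q \<le> card (children (C \<union> Q) r ?par p)"
      using finite_children[OF R', of p] ch[of p] p(1) by (intro card_mono) auto
    then show ?thesis using p by linarith
  qed
  have s: "card (insert c S) \<le> (if c \<in> S then s else Suc s)"
    using T card_insert_le_m1[of "Suc s" S c] by (auto simp: star_tree_def insert_absorb)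
  have "children C r par v = {}" if "v \<in> Q" for v
    using R that Q by (auto simp: children_def rtree_def)
  then show ?thesis
    using T R' e s chS c by (auto simp: star_tree_def ch)
qed

lemma star_tree_init:
  assumes "r \<in> V" "t \<le> card {w. E r w}"
  shows "star_tree t (insert r {w. E r w}) r (\<lambda>_. r) {r} {} 1 1 0"
proof -
  have ch: "children (insert r {w. E r w}) r (\<lambda>_. r) p = (if p = r then {w. E r w} else {})" for p
    using E_irrefl by (auto simp: children_def)
  have "acyclic ({} \<union> par_rel (insert r {w. E r w}) r (\<lambda>_. r))"
    by (rule acyclic_Un_fresh_range) (auto simp: par_rel_def acyclic_def)
  then have "rtree (insert r {w. E r w}) r (\<lambda>_. r)"
    using assms E_V E_sym by (auto simp: rtree_def)
  moreover have "{v \<in> insert r {w. E r w}. v = r \<or> r \<notin> {r}} = {r}" by auto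
  ultimately show ?thesis
    using assms(2) by (simp add: star_tree_def ch)
qed

text \<open>In a tree of maximum order no centre has a neighbour outside (\<open>S0\<close>). A vertex violating the
  bound could become a new centre, at a cost of \<open>b + 1\<close> for \<open>t\<close> new vertices (\<open>C1\<close>, \<open>C3\<close>), and
  a vertex at distance two from the tree could become one at a cost of \<open>b + 2\<close> for \<open>d + 1 \<ge> 2t\<close> new
  vertices (\<open>C2\<close>).\<close>

lemma ex_star_tree:
  assumes ne: "V \<noteq> {}"
    and conn: "\<And>A. A \<noteq> {} \<Longrightarrow> A \<subset> V \<Longrightarrow> \<exists>x\<in>A. \<exists>y\<in>V - A. E x y"
    and deg: "\<And>v. v \<in> V \<Longrightarrow> d \<le> card {w. E v w}"
    and t: "2 \<le> t" "2 * t \<le> d + 1"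
  shows "\<exists>C r par S D b. star_tree t C r par S D (Suc b) (Suc b) b \<and> t * b + d + 1 \<le> card C \<and>
    (\<forall>v\<in>V. card {w \<in> V - C. E v w} < t)"
proof -
  \<comment> \<open>One number \<open>b\<close> controls all three counters. The initial star
    supplies \<open>d + 1\<close> vertices with \<open>b = 0\<close>, and each later unit of
    \<open>b\<close> is paid for by \<open>t\<close> new vertices.\<close>
  define P where "P m \<longleftrightarrow> (\<exists>C r par S D b. star_tree t C r par S D (Suc b) (Suc b) b \<and>
    t * b + d + 1 \<le> card C \<and> card C = m)" for m
  obtain r0 where r0: "r0 \<in> V" using ne by blast
  have "P (card (insert r0 {w. E r0 w}))"
    unfolding P_def
    using star_tree_init[OF r0, of t] deg[OF r0] t E_irrefl
    by (intro exI[of _ "insert r0 {w. E r0 w}"] exI[of _ r0] exI[of _ "\<lambda>_. r0"] exI[of _ "{r0}"]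
        exI[of _ "{}"] exI[of _ 0]) auto
  moreover have "\<forall>m. P m \<longrightarrow> m \<le> card V"
    unfolding P_def star_tree_def rtree_def using finV card_mono by blast
  ultimately obtain m where m: "P m" "\<And>m'. P m' \<Longrightarrow> m' \<le> m"
    using Nat.ex_has_greatest_nat[of P _ "card V"] by blast
  then obtain C r par S D b where T: "star_tree t C r par S D (Suc b) (Suc b) b"
    and cardC: "t * b + d + 1 \<le> card C" and Cm: "card C = m"
    unfolding P_def by blast
  have R: "rtree C r par" and CV: "C \<subseteq> V" and C_ne: "C \<noteq> {}" and SC: "S \<subseteq> C"
    using T by (auto simp: star_tree_def rtree_def)
  have finC: "finite C" using rtree_finite[OF R] .
  have finQ: "finite {w \<in> V - C. E v w}" for v using finV by simp
  have max: "card C' \<le> card C" if "star_tree t C' r' par' S' D' (Suc b') (Suc b') b'"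
    "t * b' + d + 1 \<le> card C'" for C' r' par' S' D' b'
    using m(2)[of "card C'"] that Cm unfolding P_def by blast
  have S0: "{w \<in> V - C. E v w} = {}" if "v \<in> S" for v
  proof (rule ccontr)
    let ?Q = "{w \<in> V - C. E v w}"
    assume ne: "?Q \<noteq> {}"
    have "star_tree t (C \<union> ?Q) r (override_on par (\<lambda>_. v) ?Q) (insert v S) D
        (if v \<in> S then Suc b else Suc (Suc b)) (Suc b) b"
      by (rule star_tree_fan[OF T]) (use that SC in auto)
    then have T1: "star_tree t (C \<union> ?Q) r (override_on par (\<lambda>_. v) ?Q) (insert v S) D
        (Suc b) (Suc b) b"
      using that by simp
    have "card (C \<union> ?Q) = card C + card ?Q"
      using finC finQ by (intro card_Un_disjoint) auto
    moreover have "0 < card ?Q" using ne finQ by (simp add: card_gt_0_iff)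
    ultimately show False using max[OF T1] cardC by linarith
  qed
  have C1: "card {w \<in> V - C. E v w} < t" if v: "v \<in> C" for v
  proof (rule ccontr)
    let ?Q = "{w \<in> V - C. E v w}"
    assume "\<not> card ?Q < t"
    then have big: "t \<le> card ?Q" by simp
    have "star_tree t (C \<union> ?Q) r (override_on par (\<lambda>_. v) ?Q) (insert v S) D
        (if v \<in> S then Suc b else Suc (Suc b)) (Suc b) b"
      by (rule star_tree_fan[OF T v]) (use big in auto)
    then have T1: "star_tree t (C \<union> ?Q) r (override_on par (\<lambda>_. v) ?Q) (insert v S) D
        (Suc (Suc b)) (Suc (Suc b)) (Suc b)"
      by (rule star_tree_mono) auto
    have cardQ: "card (C \<union> ?Q) = card C + card ?Q"
      using finC finQ by (intro card_Un_disjoint) auto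
    have "t * Suc b + d + 1 \<le> card (C \<union> ?Q)" using cardQ cardC big by simp
    from max[OF T1 this] show False using cardQ big t by linarith
  qed
  have C2: "\<exists>y\<in>C. E v y" if "v \<in> V - C" for v
  proof (rule ccontr)
    assume nov: "\<not> (\<exists>y\<in>C. E v y)"
    \<comment> \<open>\<open>A\<close> is \<open>C\<close> together with its neighbours. An edge
      leaving \<open>A\<close> ends in a vertex \<open>c\<close> at distance exactly two from
      \<open>C\<close>, with \<open>z\<close> in between.\<close>
    define A where "A = C \<union> {w. \<exists>y\<in>C. E w y}"
    have "A \<noteq> {}" "A \<subset> V" using C_ne CV nov that E_V by (auto simp: A_def)
    from conn[OF this] obtain z c where zc: "z \<in> A" "c \<in> V - A" "E z c" by blast
    then have cC: "c \<in> V - C" "\<not> (\<exists>y\<in>C. E c y)" by (auto simp: A_def)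
    have zC: "z \<in> V - C" using zc cC E_sym E_V by blast
    then obtain y where y: "y \<in> C" "E z y" using zc by (auto simp: A_def)
    have ne: "c \<noteq> z" using zc E_irrefl by blast
    \<comment> \<open>Since \<open>c\<close> has no neighbour in \<open>C\<close>, all of
      \<open>?Q\<close> is new, and its size is at least \<open>d - 1\<close>, hence at least
      \<open>2 * t - 2\<close> and so at least \<open>t\<close>. With \<open>z\<close> and
      \<open>c\<close>, at least \<open>d + 1\<close> vertices join.\<close>
    let ?Q = "{w. E c w} - {z}"
    define par1 where "par1 = override_on par (\<lambda>_. y) {z}"
    define par2 where "par2 = override_on par1 (\<lambda>_. z) {c}"
    have T1: "star_tree t (insert z C) r par1 S (insert y D) (Suc b) (Suc (Suc b)) (Suc b)"
      unfolding par1_def by (rule star_tree_hang[OF T y(1) zC y(2)])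
    have T2: "star_tree t (insert c (insert z C)) r par2 S (insert z (insert y D))
        (Suc b) (Suc (Suc (Suc b))) (Suc (Suc b))"
      unfolding par2_def by (rule star_tree_hang[OF T1]) (use cC ne E_sym[OF zc(3)] in auto)
    have degc: "d \<le> card {w. E c w}" using deg cC by blast
    have "z \<in> {w. E c w}" using zc E_sym by blast
    then have cardQ: "d \<le> Suc (card ?Q)"
      using degc by (metis card_Suc_Diff1 finite_nb)
    have cS: "c \<notin> S" using cC SC by blast
    have "star_tree t (insert c (insert z C) \<union> ?Q) r (override_on par2 (\<lambda>_. c) ?Q) (insert c S)
        (insert z (insert y D)) (if c \<in> S then Suc b else Suc (Suc b))
        (Suc (Suc (Suc b))) (Suc (Suc b))"
      by (rule star_tree_fan[OF T2]) (use cC E_V E_irrefl cardQ t in auto)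
    then have T3: "star_tree t (insert c (insert z C) \<union> ?Q) r (override_on par2 (\<lambda>_. c) ?Q)
        (insert c S) (insert z (insert y D)) (Suc (Suc (Suc b))) (Suc (Suc (Suc b))) (Suc (Suc b))"
      by (rule star_tree_mono) (use cS in auto)
    have "card (insert c (insert z C) \<union> ?Q) = card (insert c (insert z C)) + card ?Q"
      using finC cC E_irrefl by (intro card_Un_disjoint) auto
    then have card3: "card (insert c (insert z C) \<union> ?Q) = Suc (Suc (card C)) + card ?Q"
      using finC cC zC ne by simp
    have "t * Suc (Suc b) + d + 1 \<le> card (insert c (insert z C) \<union> ?Q)"
      using card3 cardQ cardC t by simp
    from max[OF T3 this] show False using card3 by simp
  qed
  have C3: "card {w \<in> V - C. E v w} < t" if v: "v \<in> V - C" for v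
  proof (rule ccontr)
    let ?Q = "{w \<in> V - C. E v w}"
    assume "\<not> card ?Q < t"
    then have big: "t \<le> card ?Q" by simp
    obtain y where y: "y \<in> C" "E v y" using C2[OF v] by blast
    define par1 where "par1 = override_on par (\<lambda>_. y) {v}"
    have T1: "star_tree t (insert v C) r par1 S (insert y D) (Suc b) (Suc (Suc b)) (Suc b)"
      unfolding par1_def by (rule star_tree_hang[OF T y(1) v y(2)])
    have vS: "v \<notin> S" using v SC by blast
    have "star_tree t (insert v C \<union> ?Q) r (override_on par1 (\<lambda>_. v) ?Q) (insert v S)
        (insert y D) (if v \<in> S then Suc b else Suc (Suc b)) (Suc (Suc b)) (Suc b)"
      by (rule star_tree_fan[OF T1]) (use E_irrefl big in auto)
    then have T2: "star_tree t (insert v C \<union> ?Q) r (override_on par1 (\<lambda>_. v) ?Q) (insert v S)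
        (insert y D) (Suc (Suc b)) (Suc (Suc b)) (Suc b)"
      using vS by simp
    have "card (insert v C \<union> ?Q) = card (insert v C) + card ?Q"
      using finC finQ E_irrefl by (intro card_Un_disjoint) auto
    then have card2: "card (insert v C \<union> ?Q) = Suc (card C) + card ?Q"
      using finC v by simp
    have "t * Suc b + d + 1 \<le> card (insert v C \<union> ?Q)"
      using card2 cardC big by simp
    from max[OF T2 this] show False using card2 by simp
  qed
  show ?thesis using T cardC C1 C3 by blast
qed

section \<open>Absorption and assembly of the spanning tree\<close>

text \<open>Choose an extension of maximum order: a vertex with \<open>k\<close> outside neighbours
  could take them all as children and be good. Keeping \<open>par0\<close> on \<open>C0\<close>
  preserves the stars; \<open>X\<close> is exempt and later holds the centres and
  \<open>D\<close>.\<close>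

lemma ex_absorbing_tree:
  assumes T0: "rtree C0 r par0" and leaf: "\<forall>v\<in>C0 - X. children C0 r par0 v = {}"
    and k: "1 \<le> k"
  shows "\<exists>C par. rtree C r par \<and> C0 \<subseteq> C \<and> (\<forall>v\<in>C0. par v = par0 v) \<and>
    (\<forall>v\<in>C - X. children C r par v = {} \<or> k \<le> card (children C r par v)) \<and>
    (\<forall>v\<in>C. card {w \<in> V - C. E v w} < k)"
proof -
  define P where "P C par \<longleftrightarrow> rtree C r par \<and> C0 \<subseteq> C \<and> (\<forall>v\<in>C0. par v = par0 v) \<and>
    (\<forall>v\<in>C - X. children C r par v = {} \<or> k \<le> card (children C r par v))" for C par
  have "P C0 par0" using T0 leaf by (auto simp: P_def)
  then have "\<exists>par. P C0 par" by blast
  moreover have "\<forall>C. (\<exists>par. P C par) \<longrightarrow> card C \<le> card V"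
    unfolding P_def rtree_def using finV card_mono by blast
  ultimately obtain C par where C: "P C par"
    and max: "\<And>C' par'. P C' par' \<Longrightarrow> card C' \<le> card C"
    using Lattices_Big.ex_has_greatest_nat[of "\<lambda>C. \<exists>par. P C par" C0 card "Suc (card V)"]
    unfolding less_Suc_eq_le by blast
  have R: "rtree C r par" using C by (simp add: P_def)
  have finC: "finite C" using rtree_finite[OF R] .
  have "card {w \<in> V - C. E v w} < k" if v: "v \<in> C" for v
  proof (rule ccontr)
    let ?Q = "{w \<in> V - C. E v w}"
    let ?par = "override_on par (\<lambda>_. v) ?Q"
    assume "\<not> card ?Q < k"
    then have big: "k \<le> card ?Q" by simp
    have R': "rtree (C \<union> ?Q) r ?par"
      by (rule rtree_attach[OF R]) (use v E_sym in blast)+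
    have ch: "children (C \<union> ?Q) r ?par p = children C r par p \<union> {q \<in> ?Q. v = p}" for p
      by (rule children_attach[OF R]) auto
    have "card ?Q \<le> card (children (C \<union> ?Q) r ?par v)"
      using finite_children[OF R'] ch by (intro card_mono) auto
    then have "k \<le> card (children (C \<union> ?Q) r ?par v)" using big by linarith
    moreover have "children (C \<union> ?Q) r ?par p = children C r par p" if "p \<noteq> v" for p
      using ch that by auto
    moreover have "children C r par p = {}" if "p \<in> ?Q" for p
      using R that by (auto simp: children_def rtree_def)
    ultimately have good: "\<forall>p\<in>(C \<union> ?Q) - X. children (C \<union> ?Q) r ?par p = {} \<or>
        k \<le> card (children (C \<union> ?Q) r ?par p)"
      using C v unfolding P_def by (metis (no_types, lifting) Diff_iff Un_iff)
    have "?par w = par0 w" if "w \<in> C0" for w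
      using C that by (auto simp: P_def override_on_def)
    then have "P (C \<union> ?Q) ?par"
      using R' good C unfolding P_def by blast
    then have "card (C \<union> ?Q) \<le> card C" by (rule max)
    moreover have "card (C \<union> ?Q) = card C + card ?Q"
      using finC finV by (intro card_Un_disjoint) auto
    ultimately show False using big k by linarith
  qed
  then show ?thesis using C unfolding P_def by blast
qed


text \<open>Runs the star, absorption and repair stages in turn. In \<open>bounds\<close>,
  \<open>m\<close> counts the vertices left after absorption; the first inequality keeps centres
  from being exhausted, the second gives bad vertices enough candidates. The root has no parent and
  so needs \<open>k + 1\<close> children.\<close>

lemma ex_good_rtree:
  assumes ne: "V \<noteq> {}"
    and conn: "\<And>A. A \<noteq> {} \<Longrightarrow> A \<subset> V \<Longrightarrow> \<exists>x\<in>A. \<exists>y\<in>V - A. E x y"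
    and deg: "\<And>v. v \<in> V \<Longrightarrow> d \<le> card {w. E v w}"
    and t: "2 \<le> t" "2 * t \<le> d + 1" and k: "1 \<le> k"
    and bounds: "\<And>b m. t * b + d + 1 \<le> card V \<Longrightarrow> m * (d + 1 - t) \<le> (k - 1) * card V \<Longrightarrow>
      k + 1 + (k - 1) * (b + m) \<le> t \<and> t + 1 + 2 * b + (k - 1) * (b + m) \<le> d"
  shows "\<exists>r par. rtree V r par \<and> k + 1 \<le> card (children V r par r) \<and>
    (\<forall>v\<in>V. children V r par v = {} \<or> k \<le> card (children V r par v))"
proof -
  obtain C0 r par0 S D b where T0: "star_tree t C0 r par0 S D (Suc b) (Suc b) b"
    and card_C0: "t * b + d + 1 \<le> card C0" and few: "\<And>v. v \<in> V \<Longrightarrow> card {w \<in> V - C0. E v w} < t"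
    using ex_star_tree[OF ne conn deg t] by blast
  have R0: "rtree C0 r par0" using T0 by (simp add: star_tree_def)
  have "\<forall>v\<in>C0 - (S \<union> D). children C0 r par0 v = {}"
    using T0 by (simp add: star_tree_def)
  from ex_absorbing_tree[OF R0 this k] obtain C par where R: "rtree C r par" and C0C: "C0 \<subseteq> C"
    and par_eq: "\<forall>v\<in>C0. par v = par0 v"
    and good: "\<forall>v\<in>C - (S \<union> D). children C r par v = {} \<or> k \<le> card (children C r par v)"
    and few_C: "\<forall>v\<in>C. card {w \<in> V - C. E v w} < k"
    by (elim exE conjE) (rule that)
  have CV: "C \<subseteq> V" and finC: "finite C" using R rtree_finite by (auto simp: rtree_def)
  define W where "W = V - C"
  have finW: "finite W" using finV by (simp add: W_def)
  have nb_C: "d + 1 - t \<le> card {x \<in> C. E w x}" if w: "w \<in> W" for w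
  proof -
    have "{w'. E w w'} \<subseteq> {w' \<in> V - C0. E w w'} \<union> {x \<in> C. E w x}"
      using C0C E_V by blast
    then have "card {w'. E w w'} \<le> card ({w' \<in> V - C0. E w w'} \<union> {x \<in> C. E w x})"
      using finV finC by (intro card_mono) auto
    also have "\<dots> \<le> card {w' \<in> V - C0. E w w'} + card {x \<in> C. E w x}"
      by (rule card_Un_le)
    finally show ?thesis using deg[of w] few[of w] w by (simp add: W_def)
  qed
  \<comment> \<open>Double counting of the edges between \<open>W\<close> and \<open>C\<close>: each
    vertex of \<open>C\<close> sees at most \<open>k - 1\<close> vertices of
    \<open>W\<close>.\<close>
  have "card W * (d + 1 - t) \<le> (\<Sum>w\<in>W. card {x \<in> C. E w x})"
    using sum_mono[of W "\<lambda>_. d + 1 - t"] nb_C by simp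
  also have "\<dots> = (\<Sum>x\<in>C. card {w \<in> W. E w x})"
    using sum_multicount_gen[OF finW finC, of E "\<lambda>x. card {w \<in> W. E w x}"] by simp
  also have "\<dots> \<le> (\<Sum>x\<in>C. k - 1)"
  proof (rule sum_mono)
    fix x assume "x \<in> C"
    moreover have "{w \<in> W. E w x} = {w \<in> V - C. E x w}" using E_sym by (auto simp: W_def)
    ultimately show "card {w \<in> W. E w x} \<le> k - 1" using few_C by fastforce
  qed
  also have "\<dots> \<le> (k - 1) * card V"
    using card_mono[OF finV CV] by simp
  finally have W_le: "card W * (d + 1 - t) \<le> (k - 1) * card V" .
  have "card C0 \<le> card V" using C0C CV finV by (auto intro: card_mono)
  then have bnd: "k + 1 + (k - 1) * (b + card W) \<le> t"
      "t + 1 + 2 * b + (k - 1) * (b + card W) \<le> d"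
    using bounds[OF _ W_le, of b] card_C0 by auto
  have "\<exists>x. x \<in> C \<and> E w x" if "w \<in> W" for w
  proof -
    have "0 < card {x \<in> C. E w x}" using nb_C[OF that] bnd(2) by linarith
    then show ?thesis by (auto simp: card_gt_0_iff)
  qed
  then obtain f where f: "\<And>w. w \<in> W \<Longrightarrow> f w \<in> C \<and> E w (f w)" by metis
  define par' where "par' = override_on par f W"
  have V_eq: "C \<union> W = V" using CV by (auto simp: W_def)
  have R': "rtree V r par'"
    using rtree_attach[OF R, of W f] f V_eq by (auto simp: par'_def W_def)
  have ch: "children V r par' p = children C r par p \<union> {q \<in> W. f q = p}" for p
    using children_attach[OF R, of W f] V_eq by (auto simp: par'_def W_def)
  \<comment> \<open>At most \<open>b + card W\<close> vertices are bad, each lacking at most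
    \<open>k - 1\<close> children.\<close>
  define M where "M = (k - 1) * (b + card W)"
  \<comment> \<open>The vertices of \<open>W\<close> are leaves, and a vertex of \<open>C\<close>
    that receives none of them keeps its children; only \<open>D\<close> and the recipients can be
    bad.\<close>
  have "bad k r S par' \<subseteq> D \<union> f ` W"
  proof
    fix v assume v: "v \<in> bad k r S par'"
    show "v \<in> D \<union> f ` W"
    proof (rule ccontr)
      assume nv: "v \<notin> D \<union> f ` W"
      then have eq: "children V r par' v = children C r par v" using ch by auto
      show False
      proof (cases "v \<in> C")
        case True
        then show False using good v nv eq by (auto simp: bad_def)
      next
        case False
        then have "children C r par v = {}" using R by (auto simp: children_def rtree_def)
        then show False using v eq by (auto simp: bad_def)
      qed
    qed
  qed
  moreover have finD: "finite D" and finS: "finite S"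
    using T0 rtree_finite[OF R0] finite_subset by (auto simp: star_tree_def)
  ultimately have "card (bad k r S par') \<le> card (D \<union> f ` W)"
    using finW by (intro card_mono) auto
  also have "\<dots> \<le> card D + card (f ` W)" by (rule card_Un_le)
  also have "\<dots> \<le> b + card W"
    using T0 card_image_le[OF finW, of f] by (simp add: star_tree_def)
  finally have card_bad: "card (bad k r S par') \<le> b + card W" .
  have "(\<Sum>u\<in>bad k r S par'. k - card (children V r par' u)) \<le> (\<Sum>u\<in>bad k r S par'. k - 1)"
  proof (rule sum_mono)
    fix u assume "u \<in> bad k r S par'"
    then have "0 < card (children V r par' u)"
      using finite_children[OF R'] by (auto simp: bad_def card_gt_0_iff)
    then show "k - card (children V r par' u) \<le> k - 1" by linarith
  qed
  also have "\<dots> \<le> M" using card_bad by (simp add: M_def mult.commute)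
  finally have sum_le: "(\<Sum>u\<in>bad k r S par'. k - card (children V r par' u)) \<le> M" .
  have chS: "k + 1 + M \<le> card (children V r par' p)" if "p \<in> S" for p
  proof -
    have "children C0 r par0 p \<subseteq> children V r par' p"
      using C0C par_eq ch by (auto simp: children_def)
    then have "card (children C0 r par0 p) \<le> card (children V r par' p)"
      using finite_children[OF R'] by (intro card_mono)
    moreover have "t \<le> card (children C0 r par0 p)" using T0 that by (simp add: star_tree_def)
    ultimately show ?thesis using bnd(1) by (simp add: M_def)
  qed
  have nb: "card S + M \<le> card {q. E u q \<and> q \<noteq> r \<and> par' q \<in> S}" if "u \<in> bad k r S par'" for u
  proof -
    have u: "u \<in> V" using that by (simp add: bad_def)
    let ?X = "{v \<in> C0. v = r \<or> par0 v \<notin> S}" and ?B = "{q. E u q \<and> q \<noteq> r \<and> par' q \<in> S}"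
    have par'_eq: "par' q = par0 q" if "q \<in> C0" for q
      using that C0C par_eq by (auto simp: par'_def override_on_def W_def)
    \<comment> \<open>A neighbour of \<open>u\<close> lies outside \<open>C0\<close> (at most
      \<open>t - 1\<close>), or is in \<open>C0\<close> but not a child of a centre (at most
      \<open>b + 1\<close>), or can be adopted. Adding \<open>b + 1\<close> for
      \<open>card S\<close> and \<open>M\<close> gives the sum in the second bound.\<close>
    have "{w. E u w} \<subseteq> ({w \<in> V - C0. E u w} \<union> ?X) \<union> ?B"
      using E_V par'_eq by auto
    then have "card {w. E u w} \<le> card (({w \<in> V - C0. E u w} \<union> ?X) \<union> ?B)"
      using finV rtree_finite[OF R0]
      by (intro card_mono) (auto intro: finite_subset[OF _ finite_nb[of u]])
    also have "\<dots> \<le> card {w \<in> V - C0. E u w} + card ?X + card ?B"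
      by (meson add_mono card_Un_le le_refl order_trans)
    finally have "d \<le> card {w \<in> V - C0. E u w} + card ?X + card ?B"
      using deg[OF u] by linarith
    moreover have "card ?X \<le> Suc b" "card S \<le> Suc b" using T0 by (simp_all add: star_tree_def)
    ultimately show ?thesis using few[OF u] bnd(2) by (simp add: M_def)
  qed
  have "S \<subseteq> V" "r \<in> S" using T0 C0C CV by (auto simp: star_tree_def)
  then show ?thesis using repair_bad[OF R' _ _ sum_le chS nb] by blast
qed

end

section \<open>Arithmetic of the degree condition\<close>

text \<open>After dividing by \<open>\<beta> = d / (k (k - 1) (k + 6))\<close>, both claims reduce to comparing polynomials in
  \<open>j = k - 2\<close> with nonnegative coefficients; the second one is nearly tight at \<open>k = 2\<close>.\<close>

lemma degree_bounds:
  fixes k n d b m t :: nat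
  assumes k: "2 \<le> k" and dn: "k * (k - 1) * (k + 6) * n \<le> d\<^sup>2" and t: "t = (2 * d + 4) div 5"
    and b: "t * b + d + 1 \<le> n" and m: "m * (d + 1 - t) \<le> (k - 1) * n" and d: "17 \<le> d"
  shows "k + 1 + (k - 1) * (b + m) \<le> t \<and> t + 1 + 2 * b + (k - 1) * (b + m) \<le> d"
proof -
  obtain j where j: "k = j + 2" using k by (metis le_add_diff_inverse2)
  define K where "K = real k * (real k - 1) * (real k + 6)"
  define \<beta> where "\<beta> = real d / K"
  have K_eq: "K = real j ^ 3 + 11 * real j ^ 2 + 26 * real j + 16"
    by (simp add: K_def j algebra_simps power2_eq_square power3_eq_cube)
  have K0: "0 < K" unfolding K_eq by (intro add_nonneg_pos) auto
  have \<beta>0: "0 \<le> \<beta>" using K0 by (simp add: \<beta>_def)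
  have dK: "real d = K * \<beta>" using K0 by (simp add: \<beta>_def)
  have t_lo: "2 * real d / 5 \<le> real t" and t_hi: "real t \<le> (2 * real d + 4) / 5"
  proof -
    have "2 * d \<le> 5 * t" "5 * t \<le> 2 * d + 4" unfolding t by presburger+
    then have "real (2 * d) \<le> real (5 * t)" "real (5 * t) \<le> real (2 * d + 4)"
      by (simp_all only: of_nat_le_iff)
    then show "2 * real d / 5 \<le> real t" "real t \<le> (2 * real d + 4) / 5" by simp_all
  qed
  have "real (k * (k - 1) * (k + 6) * n) \<le> real (d\<^sup>2)" using dn by (simp only: of_nat_le_iff)
  then have "K * real n \<le> real d * real d"
    using k by (simp add: K_def of_nat_diff power2_eq_square)
  then have "K * real n \<le> K * (\<beta> * real d)" by (simp add: dK mult.assoc)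
  then have n_le: "real n \<le> \<beta> * real d" using K0 by simp
  have d_ge: "17 \<le> real d" and d0: "0 < real d" using d by simp_all
  have "real (t * b + d + 1) \<le> real n" using b by (simp only: of_nat_le_iff)
  then have "real t * real b + real d \<le> \<beta> * real d" using n_le by simp
  moreover have "2 * real d / 5 * real b \<le> real t * real b"
    using t_lo by (intro mult_right_mono) auto
  ultimately have "real d * (2 / 5 * real b + 1) \<le> real d * \<beta>" by (simp add: algebra_simps)
  \<comment> \<open>The \<open>- 5 / 2\<close> stems from the summand \<open>d\<close> in the lower
    bound on \<open>n\<close>; it later absorbs the additive constants of both claims.\<close>
  then have b_le: "real b \<le> 5 / 2 * \<beta> - 5 / 2" using d0 by simp
  have "real (m * (d + 1 - t)) \<le> real ((k - 1) * n)" using m by (simp only: of_nat_le_iff)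
  moreover have "t \<le> d" using t d by linarith
  ultimately have "real m * (real d + 1 - real t) \<le> (real k - 1) * real n"
    using k by (simp add: of_nat_diff add.commute)
  also have "\<dots> \<le> (real k - 1) * (\<beta> * real d)"
    using n_le k by (intro mult_left_mono) auto
  finally have "real m * (real d + 1 - real t) \<le> (real k - 1) * (\<beta> * real d)" .
  moreover have "real m * (3 / 5 * real d) \<le> real m * (real d + 1 - real t)"
    using t_hi by (intro mult_left_mono) auto
  ultimately have "real d * (3 / 5 * real m) \<le> real d * ((real k - 1) * \<beta>)"
    by (simp add: algebra_simps)
  then have m_le: "real m \<le> 5 / 3 * ((real j + 1) * \<beta>)" using d0 j by (simp add: add.commute mult.commute mult.left_commute)
  have bm: "real ((k - 1) * (b + m)) = (real j + 1) * real b + (real j + 1) * real m"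
    by (simp add: j algebra_simps)
  have jm: "(real j + 1) * real m \<le> (real j + 1) * (5 / 3 * ((real j + 1) * \<beta>))"
    using m_le by (intro mult_left_mono) auto
  have jb: "(real j + 1) * real b \<le> (real j + 1) * (5 / 2 * \<beta>) - (real j + 1) * (5 / 2)"
    and jb3: "(real j + 3) * real b \<le> (real j + 3) * (5 / 2 * \<beta>) - (real j + 3) * (5 / 2)"
    unfolding right_diff_distrib[symmetric] by (rule mult_left_mono, rule b_le, simp)+
  have j3: "0 \<le> real j ^ 3" "0 \<le> real j ^ 2" by simp_all
  \<comment> \<open>The first claim has about \<open>2 / 5 * d\<close> available, so
    \<open>3 / 10 * d\<close> leaves room for constants as \<open>d\<close> is at least 17. The
    second has \<open>3 / 5 * d\<close> left once \<open>t\<close> is subtracted.\<close>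
  have "(5 / 2 * (real j + 1) + 5 / 3 * (real j + 1) ^ 2) * \<beta> \<le> (3 / 10 * K) * \<beta>"
    using j3 \<beta>0 unfolding K_eq power2_sum
    by (intro mult_right_mono) (auto simp: field_simps)
  then have A: "(real j + 1) * (5 / 2 * \<beta>) + (real j + 1) * (5 / 3 * ((real j + 1) * \<beta>))
      \<le> 3 / 10 * real d"
    by (simp add: dK field_simps power2_eq_square)
  have "(5 / 2 * (real j + 3) + 5 / 3 * (real j + 1) ^ 2) * \<beta> \<le> (3 / 5 * K) * \<beta>"
    using j3 \<beta>0 unfolding K_eq power2_sum
    by (intro mult_right_mono) (auto simp: field_simps)
  then have B: "(real j + 3) * (5 / 2 * \<beta>) + (real j + 1) * (5 / 3 * ((real j + 1) * \<beta>))
      \<le> 3 / 5 * real d"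
    by (simp add: dK field_simps power2_eq_square)
  \<comment> \<open>Naming the products with \<beta> makes the remaining inequalities
    linear.\<close>
  define X1 X3 Y where "X1 = (real j + 1) * (5 / 2 * \<beta>)" and "X3 = (real j + 3) * (5 / 2 * \<beta>)"
    and "Y = (real j + 1) * (5 / 3 * ((real j + 1) * \<beta>))"
  note lin = A[folded X1_def Y_def] B[folded X3_def Y_def] jb[folded X1_def] jb3[folded X3_def]
    jm[folded Y_def] t_lo t_hi d_ge of_nat_0_le_iff[where 'a = real, of j]
  have "real j + 3 + ((real j + 1) * real b + (real j + 1) * real m) \<le> real t"
    using lin by argo
  then have "real (k + 1 + (k - 1) * (b + m)) \<le> real t"
    unfolding of_nat_add bm by (simp add: j)
  moreover have "real t + 1 + 2 * real b + ((real j + 1) * real b + (real j + 1) * real m) \<le> real d"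
  proof -
    have "2 * real b + (real j + 1) * real b = (real j + 3) * real b" by (simp add: algebra_simps)
    then show ?thesis using lin by argo
  qed
  then have "real (t + 1 + 2 * b + (k - 1) * (b + m)) \<le> real d"
    unfolding of_nat_add bm by simp
  ultimately show ?thesis unfolding of_nat_le_iff by blast
qed

section \<open>From parent functions to graphs\<close>

definition tree_graph :: "'a set \<Rightarrow> 'a \<Rightarrow> ('a \<Rightarrow> 'a) \<Rightarrow> 'a pair_pre_digraph" where
  "tree_graph V r par = \<lparr>pverts = V, parcs = par_rel V r par \<union> (par_rel V r par)\<inverse>\<rparr>"

lemma pcas_nth:
  "pcas u p v \<Longrightarrow> Suc i < length p \<Longrightarrow> fst (p ! Suc i) = snd (p ! i)"
proof (induction p arbitrary: u i)
  case (Cons e es)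
  then show ?case by (cases i; cases es) auto
qed simp

lemma pcas_last: "pcas u p v \<Longrightarrow> p \<noteq> [] \<Longrightarrow> snd (last p) = v"
  by (induction p arbitrary: u) (auto split: if_splits)

text \<open>Indices are taken modulo the length because in a closed walk the first arc follows the
  last one.\<close>

lemma closed_pcas_nth_mod:
  assumes "pcas u p u" "i < length p"
  shows "fst (p ! (Suc i mod length p)) = snd (p ! i)"
proof (cases "Suc i < length p")
  case True
  then show ?thesis using pcas_nth[OF assms(1)] by simp
next
  case False
  then have i: "Suc i = length p" using assms by linarith
  then have ne: "p \<noteq> []" by auto
  then have "fst (p ! 0) = u" using assms(1) by (cases p) auto
  moreover have "last p = p ! i" using last_conv_nth[OF ne] i by (metis diff_Suc_1)
  moreover have "snd (last p) = u" by (rule pcas_last[OF assms(1) ne])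
  ultimately show ?thesis unfolding i by simp
qed

context fin_graph
begin

text \<open>The first form gives induction from the root downwards, the converse a lowest vertex in
  a given set.\<close>

lemma par_rel_wf:
  assumes "rtree C r par"
  shows "wf (par_rel C r par)" "wf ((par_rel C r par)\<inverse>)"
proof -
  have "par_rel C r par = (\<lambda>v. (par v, v)) ` (C - {r})" by (auto simp: par_rel_def)
  then have "finite (par_rel C r par)" using rtree_finite[OF assms] by simp
  then show "wf (par_rel C r par)" "wf ((par_rel C r par)\<inverse>)"
    using assms by (auto simp: rtree_def intro: finite_acyclic_wf finite_acyclic_wf_converse)
qed

lemma pair_graph_tree_graph:
  assumes "rtree V r par"
  shows "pair_graph (tree_graph V r par)"
proof -
  have sub: "parcs (tree_graph V r par) \<subseteq> V \<times> V"
    using assms by (auto simp: tree_graph_def par_rel_def rtree_def)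
  show ?thesis
  proof
    show "finite (pverts (tree_graph V r par))" using finV by (simp add: tree_graph_def)
    show "finite (parcs (tree_graph V r par))" using sub finV finite_subset by blast
    show "symmetric (with_proj (tree_graph V r par))"
      unfolding symmetric_def with_proj_simps by (auto simp: tree_graph_def sym_def)
    fix e assume e: "e \<in> parcs (tree_graph V r par)"
    then show "fst e \<in> pverts (tree_graph V r par)" "snd e \<in> pverts (tree_graph V r par)"
      using sub by (auto simp: tree_graph_def)
    show "fst e \<noteq> snd e"
    proof
      assume "fst e = snd e"
      then obtain v where "v \<in> V - {r}" "par v = v"
        using e by (auto simp: tree_graph_def par_rel_def)
      then show False using assms E_irrefl[of v] unfolding rtree_def by metis
    qed
  qed
qed

lemma connected_tree_graph:
  assumes T: "rtree V r par"
  shows "Digraph_Component.connected (tree_graph V r par)"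
proof -
  let ?T = "tree_graph V r par"
  interpret T: pair_graph ?T by (rule pair_graph_tree_graph[OF T])
  have verts: "pverts ?T = V" by (simp add: tree_graph_def)
  have from_root: "r \<rightarrow>\<^sup>*\<^bsub>?T\<^esub> v" if "v \<in> V" for v
    using that
  proof (induction v rule: wf_induct_rule[OF par_rel_wf(1)[OF T]])
    case (1 v)
    show ?case
    proof (cases "v = r")
      case True
      then show ?thesis using "1.prems" verts by simp
    next
      case False
      then have pv: "(par v, v) \<in> par_rel V r par" "par v \<in> V"
        using "1.prems" T by (auto simp: par_rel_def rtree_def)
      then have "r \<rightarrow>\<^sup>*\<^bsub>?T\<^esub> par v" using "1.IH" by blast
      moreover have "(par v, v) \<in> parcs ?T" using pv by (simp add: tree_graph_def)
      ultimately show ?thesis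
        using T.reachable_adj_trans by (metis with_proj_simps(3))
    qed
  qed
  have "u \<rightarrow>\<^sup>*\<^bsub>?T\<^esub> v" if "u \<in> V" "v \<in> V" for u v
    using from_root that symmetric_reachable[OF T.sym_arcs] T.reachable_trans by metis
  then have "u \<rightarrow>\<^sup>*\<^bsub>mk_symmetric ?T\<^esub> v" if "u \<in> V" "v \<in> V" for u v
    using that T.reachable_mk_symmetricI by blast
  then show ?thesis
    using T unfolding Digraph_Component.connected_def
    by (intro strongly_connectedI) (auto simp: verts rtree_def)
qed

text \<open>On a cycle, take a vertex none of whose children lies on the cycle: both of its neighbours
  along the cycle would have to be its parent.\<close>

lemma no_cycle_tree_graph:
  assumes T: "rtree V r par" and cyc: "pre_digraph.cycle (tree_graph V r par) p"
  shows "length p < 3"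
proof (rule ccontr)
  assume "\<not> length p < 3"
  then have len: "3 \<le> length p" by simp
  let ?T = "tree_graph V r par" and ?R = "par_rel V r par" and ?n = "length p"
  interpret T: pair_graph ?T by (rule pair_graph_tree_graph[OF T])
  from cyc obtain u where aw: "T.awalk u p u" and dist: "distinct (tl (pawalk_verts u p))"
    unfolding T.cycle_def by auto
  have cas: "pcas u p u" and arcs: "set p \<subseteq> parcs ?T" using aw by (auto simp: T.awalk_def)
  have "pawalk_verts u p = fst (hd p) # map snd p"
    using T.awalk_verts_conv'[OF cas] len by auto
  then have heads: "distinct (map snd p)" using dist by simp
  obtain z where z: "z \<in> snd ` set p" and zmin: "\<And>y. (z, y) \<in> ?R \<Longrightarrow> y \<notin> snd ` set p"
    using wfE_min[OF par_rel_wf(2)[OF T], of "snd (hd p)" "snd ` set p"] len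
    by (metis converse_iff hd_in_set image_eqI list.size(3) not_numeral_le_zero)
  obtain i where i: "i < ?n" "z = snd (p ! i)" using z by (auto simp: in_set_conv_nth)
  \<comment> \<open>Cyclically, arc \<open>l\<close> precedes arc \<open>i\<close> and arc
    \<open>j\<close> follows it, so the heads of \<open>l\<close> and \<open>j\<close> are the two
    neighbours of \<open>z\<close> on the cycle. Length at least 3 makes \<open>l\<close> and
    \<open>j\<close> differ.\<close>
  define l where "l = (if i = 0 then ?n - 1 else i - 1)"
  define j where "j = Suc i mod ?n"
  have l: "l < ?n" "Suc l mod ?n = i" using i len by (auto simp: l_def)
  have j: "j < ?n" unfolding j_def by (rule mod_less_divisor) (use len in linarith)
  have lj: "l \<noteq> j" using i len by (auto simp: l_def j_def mod_if split: if_splits)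
  have pred: "fst (p ! i) = snd (p ! l)" using closed_pcas_nth_mod[OF cas l(1)] l(2) by simp
  have succ: "fst (p ! j) = z" using closed_pcas_nth_mod[OF cas i(1)] i(2) by (simp add: j_def)
  have on: "snd (p ! l) \<in> snd ` set p" "snd (p ! j) \<in> snd ` set p" using l j by auto
  have "(snd (p ! l), z) \<in> parcs ?T"
    using arcs i pred nth_mem[OF i(1)] by (metis prod.collapse subsetD)
  then have "snd (p ! l) = par z"
    using zmin on(1) by (auto simp: tree_graph_def par_rel_def)
  moreover have "(z, snd (p ! j)) \<in> parcs ?T"
    using arcs succ nth_mem[OF j] by (metis prod.collapse subsetD)
  then have "snd (p ! j) = par z"
    using zmin on(2) by (auto simp: tree_graph_def par_rel_def)
  ultimately have "map snd p ! l = map snd p ! j" using l j by simp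
  then show False using heads l(1) j lj nth_eq_iff_index_eq[of "map snd p" l j] by simp
qed

text \<open>The extra 1 is the arc to the parent, which by acyclicity is not also a child.\<close>

lemma out_degree_tree_graph:
  assumes T: "rtree V r par" and v: "v \<in> V"
  shows "out_degree (tree_graph V r par) v = card (children V r par v) + (if v = r then 0 else 1)"
proof -
  let ?A = "children V r par v \<union> (if v = r then {} else {par v})"
  have "out_arcs (tree_graph V r par) v = Pair v ` ?A"
    using v by (auto simp: out_arcs_def tree_graph_def par_rel_def children_def)
  then have "out_degree (tree_graph V r par) v = card ?A"
    by (simp add: out_degree_def card_image inj_on_def)
  moreover have "par v \<notin> children V r par v" if "v \<noteq> r"
  proof
    assume "par v \<in> children V r par v"
    then have "(v, par v) \<in> par_rel V r par" by (force simp: children_def par_rel_def)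
    moreover have "(par v, v) \<in> par_rel V r par" using v that by (auto simp: par_rel_def)
    ultimately have "(v, v) \<in> (par_rel V r par)\<^sup>+" by auto
    then show False using T by (auto simp: rtree_def acyclic_def)
  qed
  ultimately show ?thesis using finite_children[OF T] by auto
qed

end

section \<open>Hypotheses on the graph and conclusion\<close>

text \<open>If no arc left \<open>A\<close>, reachability from a vertex of \<open>A\<close> would
  stay inside \<open>A\<close>.\<close>

lemma connected_cut:
  assumes G: "pair_graph G" "Digraph_Component.connected (with_proj G)"
    and A: "A \<noteq> {}" "A \<subset> pverts G"
  shows "\<exists>x\<in>A. \<exists>y\<in>pverts G - A. (x, y) \<in> parcs G"
proof (rule ccontr)
  assume no: "\<not> ?thesis"
  interpret pair_graph G by (rule G(1))
  obtain x y where xy: "x \<in> A" "y \<in> pverts G - A" using A by blast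
  have eq: "parcs (mk_symmetric G) = parcs G"
    using adj_mk_symmetric_eq[OF sym_arcs] by simp
  have "x \<rightarrow>\<^sup>*\<^bsub>mk_symmetric G\<^esub> y"
    using G(2) xy A unfolding Digraph_Component.connected_def strongly_connected_def by auto
  then have "(x, y) \<in> (parcs G)\<^sup>*"
    using reachable_rtranclI eq by (metis with_proj_simps(3))
  then have "y \<in> A"
  proof (induction rule: rtrancl_induct)
    case base
    show ?case by (rule xy(1))
  next
    case (step y z)
    then show ?case using no in_arcsD2 by blast
  qed
  then show False using xy by blast
qed

text \<open>For \<open>k\<close> at least 2, \<open>sqrt (2 * k)\<close> is at least 2, so the
  bracket is at least \<open>k + 6\<close>; this weaker bound is free of roots.\<close>

lemma square_min_degree_ge:
  fixes k n d :: nat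
  assumes k: "2 \<le> k"
    and d: "sqrt (real k * (real k - 1) * (real k + 2 * sqrt (2 * real k) + 2) * real n) \<le> real d"
  shows "k * (k - 1) * (k + 6) * n \<le> d\<^sup>2"
proof -
  have "2 \<le> sqrt (2 * real k)" using k by (intro real_le_rsqrt) (simp add: power2_eq_square)
  then have "real k * (real k - 1) * (real k + 6) * real n
      \<le> real k * (real k - 1) * (real k + 2 * sqrt (2 * real k) + 2) * real n"
    using k by (intro mult_right_mono mult_left_mono) auto
  also have "\<dots> \<le> (real d)\<^sup>2" by (rule sqrt_le_D[OF d])
  finally have "real (k * (k - 1) * (k + 6) * n) \<le> real (d\<^sup>2)"
    using k by (simp add: of_nat_diff)
  then show ?thesis unfolding of_nat_le_iff .
qed

theorem theorem1:
  fixes k n :: nat and G :: "'a pair_pre_digraph"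
  assumes "k \<ge> 2"
    and "pair_graph G"
    and "Digraph_Component.connected G"
    and "card (verts G) = n"
    and "real (min_degree G) \<ge>
           sqrt (real k * (real k - 1) * (real k + 2 * sqrt (2 * real k) + 2) * real n)"
  shows "\<exists>T. is_2_k_ST k T G"
proof -
  interpret G: pair_graph G by (rule assms(2))
  let ?V = "pverts G" and ?E = "\<lambda>x y. (x, y) \<in> parcs G"
  interpret fin_graph ?V ?E
    by unfold_locales
      (use G.pair_finite_verts G.in_arcsD1 G.in_arcsD2 G.arcs_symmetric G.no_loops' in blast)+
  define d where "d = min_degree G"
  define t where "t = (2 * d + 4) div 5"
  have ne: "?V \<noteq> {}"
    using assms(3) by (auto simp: Digraph_Component.connected_def strongly_connected_def)
  have n: "card ?V = n" using assms(4) by simp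
  have out: "out_degree G v = card {w. ?E v w}" for v
  proof -
    have "out_arcs G v = Pair v ` {w. ?E v w}" by (auto simp: out_arcs_def)
    then show ?thesis by (simp add: out_degree_def card_image inj_on_def)
  qed
  have deg: "d \<le> card {w. ?E v w}" if "v \<in> ?V" for v
    using that finV unfolding d_def min_degree_def out[symmetric] by auto
  have dn: "k * (k - 1) * (k + 6) * n \<le> d\<^sup>2"
    using square_min_degree_ge[OF assms(1)] assms(5) by (simp add: d_def)
  obtain v0 where v0: "v0 \<in> ?V" using ne by blast
  have "card (insert v0 {w. ?E v0 w}) \<le> card ?V"
    using v0 E_V finV by (intro card_mono) auto
  then have dn1: "d + 1 \<le> n" using deg[OF v0] E_irrefl n by simp
  \<comment> \<open>The factor in \<open>k\<close> is at least 16, so \<open>d * d\<close> is at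
    least \<open>16 * n\<close>, hence at least \<open>16 * (d + 1)\<close>, which forces
    \<open>d\<close> above 16.\<close>
  have "2 * 1 * 8 * n \<le> k * (k - 1) * (k + 6) * n"
    using assms(1) by (intro mult_le_mono) auto
  then have "16 * n \<le> d * d" using dn unfolding power2_eq_square by linarith
  with mult_le_mono2[OF dn1] have "16 * (d + 1) \<le> d * d" by (rule order_trans)
  have d17: "17 \<le> d"
  proof (rule ccontr)
    assume "\<not> 17 \<le> d"
    then have "d * d \<le> 16 * d" by (intro mult_le_mono1) simp
    with \<open>16 * (d + 1) \<le> d * d\<close> have "16 * (d + 1) \<le> 16 * d" by (rule order_trans)
    then show False by simp
  qed
  have conn: "\<exists>x\<in>A. \<exists>y\<in>?V - A. ?E x y" if "A \<noteq> {}" "A \<subset> ?V" for A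
    using connected_cut[OF assms(2,3) that] .
  obtain r par where T: "rtree ?V r par" and root: "k + 1 \<le> card (children ?V r par r)"
    and good: "\<And>v. v \<in> ?V \<Longrightarrow> children ?V r par v = {} \<or> k \<le> card (children ?V r par v)"
  proof -
    have "2 \<le> t" "2 * t \<le> d + 1" using d17 unfolding t_def by presburger+
    from ex_good_rtree[OF ne conn deg this, of k] show ?thesis
      using degree_bounds[OF assms(1) dn t_def _ _ d17] assms(1) n that by auto
  qed
  let ?T = "tree_graph ?V r par"
  have pg: "pair_graph ?T" by (rule pair_graph_tree_graph[OF T])
  have "parcs ?T \<subseteq> parcs G"
    using T G.arcs_symmetric by (auto simp: tree_graph_def par_rel_def rtree_def)
  moreover have "wf_digraph (with_proj ?T)"
    using pg by (simp add: wf_digraph_wp_iff pair_graph_def pair_digraph_def pair_fin_digraph_def)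
  moreover have "pverts ?T = ?V" by (simp add: tree_graph_def)
  ultimately have "spanning ?T G"
    using G.wf_digraph_axioms by (auto simp: spanning_def subgraph_def)
  moreover have "undirected_tree ?T"
    unfolding undirected_tree_def using pg connected_tree_graph[OF T] no_cycle_tree_graph[OF T]
    by (meson not_less)
  \<comment> \<open>A non-root has degree 1 or, counting its parent, at least \<open>k + 1\<close>;
    the root has at least \<open>k + 1\<close> children.\<close>
  moreover have "out_degree ?T v \<notin> {2..k}" if "v \<in> ?V" for v
    using out_degree_tree_graph[OF T that] good[OF that] root by auto
  then have "(\<Union>i\<in>{2..k}. verts_of_degree i ?T) = {}"
    by (auto simp: verts_of_degree_def tree_graph_def)
  ultimately show ?thesis
    by (auto simp: is_2_k_ST_def undirected_spanning_tree_def)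
qed

end
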